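(* Let $p\geqslant3$ and let $\pi\in S_p$ be such that both $\pi$ and its reverse $\overline{\pi}$ are non-self-overlapping. Let $m\geqslant0$ be a fixed integer. Then for any positive integer $r$, the probability that a uniform random permutation $\sigma\in S_n$ has exactly $m$ very tight occurrences of $\pi$ satisfies, as $n\to\infty$, \[ \mathbb{P}(\pi\text{ very tightly occurs in }\sigma\ m\text{ times})=\sum_{k=(p-2)m}^{r-1}\frac{c_k}{n^{\underline{k}}}+O\left(\frac{1}{n^r}\right), \] where $n^{\underline{k}}=n(n-1)\ldots(n-k+1)$ are the falling factorials and \[ c_k=(-1)^m\sum_{i=\lceil k/(p-1)\rceil}^{\lfloor k/(p-2)\rfloor}\binom{i}{m}\frac{(-1)^{(p-1)i-k}}{\big((p-1)i-k\big)!}\binom{i}{k-(p-2)i}. \]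
   Context: $S_n$ denotes the set of permutations $\sigma=\sigma_1\ldots\sigma_n$ of $\{1,\ldots,n\}$. Two sequences of distinct integers $\pi_1\ldots\pi_k$ and $\tau_1\ldots\tau_k$ are isomorphic if $\pi_i>\pi_j\Leftrightarrow\tau_i>\tau_j$ for all $i,j$. A permutation $\sigma\in S_n$, $n\geqslant1$, is self-overlapping if there is an integer $1\leqslant k<n$ such that: (1) $\{1,\ldots,k\}$ is invariant under $\sigma$; (2) $\{n-k+1,\ldots,n\}$ is invariant under $\sigma$; (3) $\sigma_1\ldots\sigma_k$ and $\sigma_{n-k+1}\ldots\sigma_n$ are isomorphic. Otherwise $\sigma$ is non-self-overlapping. The reverse of $\pi=\pi_1\pi_2\ldots\pi_p$ is $\overline{\pi}=\pi_p\pi_{p-1}\ldots\pi_1$. A very tight occurrence of $\pi\in S_p$ in $\sigma\in S_n$ is a pair of integers $0\leqslant i,h\leqslant n-p$ such that $\sigma_{i+j}=\pi_j+h$ for all $1\leqslant j\leqslant p$. The permutation $\pi$ and the integers $m,r$ are fixed as $n\to\infty$, so the implied constant may depend on them. Empty sums are $0$, and $\binom{i}{m}=0$ if $i<m$. *)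

theory Defs
  imports
    "HOL-Probability.Probability"
    "HOL-Combinatorics.Combinatorics"
    "HOL-Library.Landau_Symbols"
begin

(* A sequence a_1 ... a_k is a function on nat, of which only the values at 1, ..., k matter.
   The set S_n is rendered as the set of functions permuting {1..n} (the identity elsewhere). *)

definition Sym :: "nat \<Rightarrow> (nat \<Rightarrow> nat) set" where
  "Sym n = {\<sigma>. \<sigma> permutes {1..n}}"

definition isomorphic_seqs :: "nat \<Rightarrow> (nat \<Rightarrow> nat) \<Rightarrow> (nat \<Rightarrow> nat) \<Rightarrow> bool" where
  "isomorphic_seqs k a b \<longleftrightarrow> (\<forall>i\<in>{1..k}. \<forall>j\<in>{1..k}. a i > a j \<longleftrightarrow> b i > b j)"

definition self_overlapping :: "nat \<Rightarrow> (nat \<Rightarrow> nat) \<Rightarrow> bool" where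
  "self_overlapping n \<sigma> \<longleftrightarrow>
     (\<exists>k. 1 \<le> k \<and> k < n
        \<and> \<sigma> ` {1..k} = {1..k}
        \<and> \<sigma> ` {n - k + 1..n} = {n - k + 1..n}
        \<and> isomorphic_seqs k \<sigma> (\<lambda>j. \<sigma> (n - k + j)))"

definition reverse_perm :: "nat \<Rightarrow> (nat \<Rightarrow> nat) \<Rightarrow> (nat \<Rightarrow> nat)" where
  "reverse_perm p \<pi> = (\<lambda>j. if j \<in> {1..p} then \<pi> (p + 1 - j) else j)"

(* The bounds i, h \<le> n - p are written additively, so that there is no occurrence when n < p. *)

definition very_tight_occurrences ::
    "nat \<Rightarrow> (nat \<Rightarrow> nat) \<Rightarrow> nat \<Rightarrow> (nat \<Rightarrow> nat) \<Rightarrow> (nat \<times> nat) set" where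
  "very_tight_occurrences p \<pi> n \<sigma> =
     {(i, h). i + p \<le> n \<and> h + p \<le> n \<and> (\<forall>j\<in>{1..p}. \<sigma> (i + j) = \<pi> j + h)}"

definition prob_very_tight :: "nat \<Rightarrow> (nat \<Rightarrow> nat) \<Rightarrow> nat \<Rightarrow> nat \<Rightarrow> real" where
  "prob_very_tight p \<pi> m n =
     measure_pmf.prob (pmf_of_set (Sym n)) {\<sigma>. card (very_tight_occurrences p \<pi> n \<sigma>) = m}"

definition falling_factorial :: "nat \<Rightarrow> nat \<Rightarrow> real" where
  "falling_factorial n k = (\<Prod>j<k. real n - real j)"

(* For p \<ge> 3 the range of i ensures (p - 2) * i \<le> k \<le> (p - 1) * i, so none of the subtractions
   on nat truncates. *)

definition vt_coeff :: "nat \<Rightarrow> nat \<Rightarrow> nat \<Rightarrow> real" where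
  "vt_coeff p m k = (-1) ^ m *
     (\<Sum>i = nat \<lceil>real k / real (p - 1)\<rceil>..nat \<lfloor>real k / real (p - 2)\<rfloor>.
        real (i choose m)
        * ((-1) ^ ((p - 1) * i - k) / fact ((p - 1) * i - k))
        * real (i choose (k - (p - 2) * i)))"

end

theory Submission imports Defs begin

text \<open>
  Let \<open>X\<close> be the number of very tight occurrences of \<open>\<pi>\<close> in a random permutation of size \<open>n\<close>. Two
  occurrences whose windows of positions meet also have windows of values that meet in equally many
  points, so the second window is the first one shifted along a diagonal; then an end of \<open>\<pi>\<close> or of
  its reverse repeats the other end, which is what being non-self-overlapping forbids
  (\<open>occurrences_disjoint\<close>). A set of \<open>s\<close> occurrences is therefore a choice of \<open>s\<close> disjoint windows of
  positions, \<open>s\<close> disjoint windows of values and a matching between them, and any such configuration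
  is realised by exactly \<open>(n - p s)!\<close> permutations. The count of the configurations makes the
  binomial moments explicit (\<open>sum_choose_occurrences\<close>): the mean of \<open>X choose s\<close> is
  \<open>(n - (p - 1) s choose s)\<close> divided by the falling factorial of \<open>n\<close> of order \<open>(p - 1) s\<close>.

  The numerator is, by Vandermonde's identity, a combination of products of consecutive integers that
  cancel against the last factors of the denominator. Each binomial moment thus becomes a finite sum
  of inverse falling factorials of orders between \<open>(p - 2) s\<close> and \<open>(p - 1) s\<close>
  (\<open>moment_expansion\<close>). Because \<open>p \<ge> 3\<close>, the lowest order is at least \<open>s\<close>, so only finitely many
  moments contribute to a given order. Inclusion and exclusion may then be stopped after
  \<open>max r (m + 1)\<close> terms: the error is bounded by a constant multiple of the first omitted moment
  (\<open>exactly_m_truncated\<close>), and collecting the terms of each order gives the coefficients \<open>c\<^sub>k\<close>.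
\<close>

section \<open>Occurrences of a non-self-overlapping pattern are disjoint\<close>

text \<open>
  Commuting with a shift by \<open>d\<close> is enough for a self-overlap of length \<open>k = p - d\<close>. The two
  invariance conditions follow: as \<open>\<rho> j + d\<close> is a value of \<open>\<rho>\<close>, it is at most \<open>p\<close>, which bounds
  \<open>\<rho> j\<close> by \<open>k\<close>.
\<close>

lemma self_overlappingI:
  assumes \<rho>: "\<rho> \<in> Sym p" and d: "0 < d" "d < p"
    and shift: "\<And>j. j \<in> {1..p - d} \<Longrightarrow> \<rho> (j + d) = \<rho> j + d"
  shows "self_overlapping p \<rho>"
proof -
  define k where "k = p - d"
  have k: "1 \<le> k" "k < p" "p - k = d" using d by (auto simp: k_def)
  have perm: "\<rho> permutes {1..p}" using \<rho> by (simp add: Sym_def)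
  have inj: "inj_on \<rho> A" for A using perm permutes_inj_on by blast
  have "\<rho> j \<in> {1..k}" if "j \<in> {1..k}" for j
  proof -
    have "\<rho> (j + d) \<in> {1..p}" "\<rho> j \<in> {1..p}"
      using that k d perm by (auto simp: permutes_in_image k_def simp del: atLeastAtMost_iff) auto
    then show ?thesis using shift[of j] that by (auto simp: k_def)
  qed
  then have low: "\<rho> ` {1..k} = {1..k}"
    by (intro endo_inj_surj) (auto intro: inj)
  have eq: "{d + 1..p} = (\<lambda>j. j + d) ` {1..k}"
    using d by (simp add: k_def image_add_atLeastAtMost')
  have "\<rho> ` {d + 1..p} = (\<lambda>j. j + d) ` \<rho> ` {1..k}"
    unfolding eq image_image using shift by (intro image_cong) (auto simp: k_def)
  then have high: "\<rho> ` {d + 1..p} = {d + 1..p}"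
    using low eq by metis
  have "isomorphic_seqs k \<rho> (\<lambda>j. \<rho> (p - k + j))"
    using shift k by (auto simp: isomorphic_seqs_def k_def add.commute)
  then show ?thesis
    unfolding self_overlapping_def using k low high by auto
qed

lemma reverse_perm_in_Sym:
  assumes "\<pi> \<in> Sym p"
  shows "reverse_perm p \<pi> \<in> Sym p"
proof -
  have perm: "\<pi> permutes {1..p}" using assms by (simp add: Sym_def)
  have "bij_betw (\<lambda>j. p + 1 - j) {1..p} {1..p}"
    by (rule bij_betw_byWitness[where f' = "\<lambda>j. p + 1 - j"]) auto
  then have "bij_betw (\<pi> \<circ> (\<lambda>j. p + 1 - j)) {1..p} {1..p}"
    using permutes_imp_bij[OF perm] by (rule bij_betw_trans)
  then have "bij_betw (reverse_perm p \<pi>) {1..p} {1..p}"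
    by (rule bij_betw_cong[THEN iffD1, rotated]) (auto simp: reverse_perm_def)
  then show ?thesis
    unfolding Sym_def by (auto intro!: bij_imp_permutes simp: reverse_perm_def)
qed

text \<open>
  The permutation carries the common positions of two occurrences onto their common values, so both
  overlaps have the same size and the occurrences are shifted by the same amount \<open>d\<close> in position and
  in value. An upward shift is a self-overlap of \<open>\<pi>\<close>, a downward one a self-overlap of its reverse.
  The same equality of sizes settles occurrences that share values but no positions.
\<close>

lemma occurrences_disjoint_aux:
  assumes \<pi>: "\<pi> \<in> Sym p"
    and nso: "\<not> self_overlapping p \<pi>" "\<not> self_overlapping p (reverse_perm p \<pi>)"
    and \<sigma>: "\<sigma> permutes T"
    and occ: "\<And>j. j \<in> {1..p} \<Longrightarrow> \<sigma> (i + j) = \<pi> j + h"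
    and occ': "\<And>j. j \<in> {1..p} \<Longrightarrow> \<sigma> (i' + j) = \<pi> j + h'"
    and less: "i < i'"
  shows "i + p \<le> i' \<and> (h + p \<le> h' \<or> h' + p \<le> h)"
proof (rule ccontr)
  assume overlap: "\<not> ?thesis"
  have perm: "\<pi> permutes {1..p}" using \<pi> by (simp add: Sym_def)
  have img: "\<sigma> ` {a + 1..a + p} = {b + 1..b + p}"
    if "\<And>j. j \<in> {1..p} \<Longrightarrow> \<sigma> (a + j) = \<pi> j + b" for a b
  proof -
    have "{a + 1..a + p} = (\<lambda>j. a + j) ` {1..p}"
      by (simp add: add.commute)
    then have "\<sigma> ` {a + 1..a + p} = (\<lambda>j. \<sigma> (a + j)) ` {1..p}"
      by (simp only: image_image)
    also have "\<dots> = (\<lambda>j. j + b) ` \<pi> ` {1..p}"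
      unfolding image_image using that by (intro image_cong) auto
    also have "\<dots> = {b + 1..b + p}"
      by (simp only: permutes_image[OF perm] image_add_atLeastAtMost' add.commute)
    finally show ?thesis .
  qed
  have "\<sigma> ` ({i + 1..i + p} \<inter> {i' + 1..i' + p}) = {h + 1..h + p} \<inter> {h' + 1..h' + p}"
    by (simp only: image_Int[OF permutes_inj[OF \<sigma>]] img[OF occ] img[OF occ'])
  then have "card ({h + 1..h + p} \<inter> {h' + 1..h' + p}) = card ({i + 1..i + p} \<inter> {i' + 1..i' + p})"
    using card_image[OF permutes_inj_on[OF \<sigma>]] by metis
  then have card_eq: "min (h + p) (h' + p) - max h h' = i + p - i'"
    using less by (simp add: Int_atLeastAtMost)
  define d where "d = i' - i"
  have d: "0 < d" "d < p" "i' = i + d" and h: "h' = h + d \<or> h = h' + d"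
    using card_eq overlap less by (auto simp: d_def min_def max_def split: if_splits)
  have meet: "\<pi> (j + d) + h = \<pi> j + h'" if "j \<in> {1..p - d}" for j
  proof -
    have "j + d \<in> {1..p}" "j \<in> {1..p}" using that d by auto
    from occ[OF this(1)] occ'[OF this(2)] show ?thesis using d by (simp add: ac_simps)
  qed
  from h show False
  proof
    assume "h' = h + d"
    then have "self_overlapping p \<pi>"
      using d meet by (intro self_overlappingI[OF \<pi>, of d]) auto
    with nso(1) show False by blast
  next
    assume h: "h = h' + d"
    have "reverse_perm p \<pi> (j + d) = reverse_perm p \<pi> j + d" if "j \<in> {1..p - d}" for j
    proof -
      have j: "p + 1 - (j + d) \<in> {1..p - d}" "p + 1 - (j + d) + d = p + 1 - j"
        using that by auto
      have "\<pi> (p + 1 - (j + d)) = \<pi> (p + 1 - j) + d"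
        using meet[OF j(1)] h unfolding j(2) by simp
      moreover have "j + d \<in> {1..p}" "j \<in> {1..p}" using that d by auto
      ultimately show ?thesis by (simp only: reverse_perm_def if_True)
    qed
    then have "self_overlapping p (reverse_perm p \<pi>)"
      using d by (intro self_overlappingI[OF reverse_perm_in_Sym[OF \<pi>], of d]) auto
    with nso(2) show False by blast
  qed
qed

section \<open>Counting configurations of disjoint occurrences\<close>

definition separated :: "nat \<Rightarrow> nat set \<Rightarrow> bool" where
  "separated p A \<longleftrightarrow> (\<forall>a\<in>A. \<forall>b\<in>A. a < b \<longrightarrow> a + p \<le> b)"

text \<open>
  A window of length \<open>p\<close> is represented by the number of points before it, as in the pairs
  \<open>(i, h)\<close> that describe occurrences.
\<close>

definition placements :: "nat \<Rightarrow> nat \<Rightarrow> nat \<Rightarrow> nat set set" where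
  "placements p n s = {A. A \<subseteq> {i. i + p \<le> n} \<and> card A = s \<and> separated p A}"

lemma placements_subset_Pow: "placements p n s \<subseteq> Pow {..n}"
  by (auto simp: placements_def)

lemma finite_placements: "finite (placements p n s)"
  by (rule finite_subset[OF placements_subset_Pow]) simp

lemma finite_of_placement: "A \<in> placements p n s \<Longrightarrow> finite A"
  using placements_subset_Pow by (metis Pow_iff finite_atMost finite_subset subsetD)

text \<open>Either the last possible window is unused, or it is used and the others lie before it.\<close>

lemma placements_Suc:
  assumes "1 \<le> p" "p \<le> n"
  shows "placements p n (Suc s) =
    placements p (n - 1) (Suc s) \<union> insert (n - p) ` placements p (n - p) s"
    (is "?L = ?R1 \<union> ?R2")
proof (intro equalityI subsetI)
  fix A assume A: "A \<in> ?L"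
  have fin: "finite A" using A by (rule finite_of_placement)
  show "A \<in> ?R1 \<union> ?R2"
  proof (cases "n - p \<in> A")
    case False
    have "i + p \<le> n - 1" if "i \<in> A" for i
    proof -
      have "i + p \<le> n" "i \<noteq> n - p" using A that False by (auto simp: placements_def)
      then show ?thesis by auto
    qed
    then have "A \<in> ?R1" using A by (auto simp: placements_def)
    then show ?thesis ..
  next
    case True
    have "i + p \<le> n - p" if "i \<in> A - {n - p}" for i
    proof -
      have "i + p \<le> n" "i \<noteq> n - p" using A that by (auto simp: placements_def)
      then have "i < n - p" by auto
      then show ?thesis using A that True by (auto simp: placements_def separated_def)
    qed
    then have "A - {n - p} \<in> placements p (n - p) s"
      using A True fin by (auto simp: placements_def separated_def)
    moreover have "A = insert (n - p) (A - {n - p})" using True by auto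
    ultimately show ?thesis by blast
  qed
next
  fix A assume "A \<in> ?R1 \<union> ?R2"
  then show "A \<in> ?L"
  proof
    assume "A \<in> ?R1"
    then show ?thesis by (force simp: placements_def)
  next
    assume "A \<in> ?R2"
    then obtain B where B: "B \<in> placements p (n - p) s" "A = insert (n - p) B" by blast
    have le: "b + p \<le> n - p" if "b \<in> B" for b using B(1) that by (auto simp: placements_def)
    then have "n - p \<notin> B" using assms by force
    then have "card A = Suc s"
      using B finite_of_placement[OF B(1)] by (simp add: placements_def)
    moreover have "separated p A"
      using B le by (fastforce simp: placements_def separated_def)
    moreover have "A \<subseteq> {i. i + p \<le> n}" using B le assms by fastforce
    ultimately show ?thesis by (simp add: placements_def)
  qed
qed

text \<open>
  Shrinking each window to a point leaves \<open>s\<close> marked points among \<open>n - (p - 1) s\<close>. The induction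
  checks Pascal's rule for this formula. The formula stays correct when there is no room for \<open>s\<close>
  windows: truncated subtraction then makes the upper index smaller than \<open>s\<close>.
\<close>

lemma card_placements:
  assumes "1 \<le> p"
  shows "card (placements p n s) = (n - (p - 1) * s) choose s"
proof (induction n arbitrary: s rule: less_induct)
  case (less n)
  show ?case
  proof (cases s)
    case 0
    have "placements p n 0 = {{}}"
    proof (intro equalityI subsetI)
      fix A assume A: "A \<in> placements p n 0"
      then show "A \<in> {{}}" using finite_of_placement[OF A] by (auto simp: placements_def)
    qed (auto simp: placements_def separated_def)
    then show ?thesis using 0 by simp
  next
    case (Suc t)
    show ?thesis
    proof (cases "p \<le> n")
      case False
      then have "{i. i + p \<le> n} = {}" by auto
      then have "placements p n s = {}" using Suc unfolding placements_def by (auto simp del: Collect_empty_eq)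
      moreover have "n - (p - 1) * s < s" using False Suc by auto
      ultimately show ?thesis by simp
    next
      case True
      have inj: "inj_on (insert (n - p)) (placements p (n - p) t)"
      proof (rule inj_onI)
        fix A B assume "A \<in> placements p (n - p) t" "B \<in> placements p (n - p) t"
          and eq: "insert (n - p) A = insert (n - p) B"
        then have "n - p \<notin> A" "n - p \<notin> B" using assms by (auto simp: placements_def)
        with eq show "A = B" by (metis insert_ident)
      qed
      have disj: "placements p (n - 1) s \<inter> insert (n - p) ` placements p (n - p) t = {}"
        using True assms by (auto simp: placements_def)
      have "card (placements p n s) =
          card (placements p (n - 1) s) + card (placements p (n - p) t)"
        unfolding Suc placements_Suc[OF assms True]
        using disj unfolding Suc
        by (subst card_Un_disjoint) (auto simp: finite_placements card_image[OF inj])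
      also have "\<dots> = (n - 1 - (p - 1) * s choose s) + (n - p - (p - 1) * t choose t)"
        using less assms True by simp
      also have "n - p - (p - 1) * t = n - 1 - (p - 1) * s"
        using assms True Suc by simp
      also have "(n - 1 - (p - 1) * s choose s) + (n - 1 - (p - 1) * s choose t) =
          (n - (p - 1) * s choose s)"
      proof (cases "(p - 1) * s \<le> n - 1")
        case True
        then have "n - (p - 1) * s = Suc (n - 1 - (p - 1) * s)"
          using \<open>p \<le> n\<close> assms by linarith
        then show ?thesis using Suc by simp
      next
        case False
        then have "t \<noteq> 0" using Suc \<open>p \<le> n\<close> by (intro notI) auto
        then show ?thesis using False Suc by simp
      qed
      finally show ?thesis .
    qed
  qed
qed

text \<open>
  The graphs of the bijections from \<open>A\<close> to \<open>B\<close>; as sets of pairs they can be compared with sets of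
  occurrences.
\<close>

definition matchings :: "'a set \<Rightarrow> 'b set \<Rightarrow> ('a \<times> 'b) set set" where
  "matchings A B = {S. inj_on fst S \<and> inj_on snd S \<and> fst ` S = A \<and> snd ` S = B}"

lemma card_matchings:
  assumes "finite A" "finite B" "card A = card B"
  shows "card (matchings A B) = fact (card A)"
proof -
  obtain \<phi> where \<phi>: "bij_betw \<phi> A B"
    using finite_same_card_bij[OF assms] by blast
  define graph where "graph \<tau> = (\<lambda>a. (a, \<phi> (\<tau> a))) ` A" for \<tau>
  have "bij_betw graph {\<tau>. \<tau> permutes A} (matchings A B)"
  proof (rule bij_betwI')
    fix \<tau> \<tau>' assume \<tau>: "\<tau> \<in> {\<tau>. \<tau> permutes A}" "\<tau>' \<in> {\<tau>. \<tau> permutes A}"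
    show "graph \<tau> = graph \<tau>' \<longleftrightarrow> \<tau> = \<tau>'"
    proof
      assume "graph \<tau> = graph \<tau>'"
      then have eq: "\<phi> (\<tau> a) = \<phi> (\<tau>' a)" if "a \<in> A" for a
        using that unfolding graph_def by blast
      show "\<tau> = \<tau>'"
      proof
        fix a show "\<tau> a = \<tau>' a"
        proof (cases "a \<in> A")
          case True
          then show ?thesis
            using eq[OF True] \<phi> \<tau> by (auto simp: bij_betw_def permutes_in_image dest: inj_onD)
        next
          case False
          then show ?thesis using \<tau> by (simp add: permutes_not_in)
        qed
      qed
    qed simp
  next
    fix \<tau> assume "\<tau> \<in> {\<tau>. \<tau> permutes A}"
    then have bij: "bij_betw (\<phi> \<circ> \<tau>) A B"
      using \<phi> by (auto intro: bij_betw_trans permutes_imp_bij)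
    then show "graph \<tau> \<in> matchings A B"
      by (auto simp: matchings_def graph_def image_image bij_betw_def inj_on_def)
  next
    fix S assume S: "S \<in> matchings A B"
    then have bfst: "bij_betw fst S A" and bsnd: "bij_betw snd S B"
      by (auto simp: matchings_def bij_betw_def)
    define f where "f = inv_into A \<phi> \<circ> (snd \<circ> inv_into S fst)"
    have f: "bij_betw f A A"
      unfolding f_def by (intro bij_betw_trans[OF bij_betw_trans[OF bij_betw_inv_into[OF bfst] bsnd]
          bij_betw_inv_into[OF \<phi>]])
    define \<tau> where "\<tau> a = (if a \<in> A then f a else a)" for a
    have "bij_betw \<tau> A A"
      using f by (rule bij_betw_cong[THEN iffD1, rotated]) (simp add: \<tau>_def)
    then have "\<tau> permutes A" by (rule bij_imp_permutes) (simp add: \<tau>_def)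
    moreover have "S = graph \<tau>"
    proof -
      have "(a, \<phi> (\<tau> a)) = inv_into S fst a" if "a \<in> A" for a
      proof -
        have "fst (inv_into S fst a) = a"
          using bfst that by (simp add: bij_betw_inv_into_right)
        moreover have "snd (inv_into S fst a) \<in> B"
          using that bij_betw_apply[OF bij_betw_trans[OF bij_betw_inv_into[OF bfst] bsnd]] by simp
        then have "\<phi> (\<tau> a) = snd (inv_into S fst a)"
          using that bij_betw_inv_into_right[OF \<phi>] by (simp add: \<tau>_def f_def)
        ultimately show ?thesis by (simp add: prod_eq_iff)
      qed
      then have "graph \<tau> = inv_into S fst ` A" unfolding graph_def by (rule image_cong[OF refl])
      then show ?thesis using bij_betw_inv_into[OF bfst] by (simp add: bij_betw_def)
    qed
    ultimately show "\<exists>\<tau>\<in>{\<tau>. \<tau> permutes A}. S = graph \<tau>" by blast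
  qed
  then show ?thesis
    using card_permutations[OF refl assms(1)] by (simp add: bij_betw_same_card)
qed

text \<open>
  Extend the prescribed values to one permutation \<open>G\<close> of \<open>T\<close>. Composition with \<open>G\<close> turns the
  permutations that fix every prescribed position into those that take the prescribed values.
\<close>

lemma card_permutations_prescribed:
  assumes T: "finite T"
    and e: "inj_on e J" "e ` J \<subseteq> T" and v: "inj_on v J" "v ` J \<subseteq> T"
  shows "card {\<sigma>. \<sigma> permutes T \<and> (\<forall>q\<in>J. \<sigma> (e q) = v q)} = fact (card T - card J)"
proof -
  define P where "P = e ` J"
  define Q where "Q = v ` J"
  have sub: "P \<subseteq> T" "Q \<subseteq> T" using e v by (auto simp: P_def Q_def)
  have cardP: "card P = card J" "card Q = card J"
    using e v by (auto simp: P_def Q_def card_image)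
  have fin: "finite P" "finite Q" using sub T finite_subset by auto
  obtain g where g: "bij_betw g (T - P) (T - Q)"
    using finite_same_card_bij[of "T - P" "T - Q"] T sub fin cardP
    by (auto simp: card_Diff_subset)
  have f: "bij_betw (v \<circ> inv_into J e) P Q"
    using e v by (intro bij_betw_trans[OF bij_betw_inv_into]) (auto simp: bij_betw_def P_def Q_def)
  define G where "G x = (if x \<in> P then v (inv_into J e x) else if x \<in> T then g x else x)" for x
  have "bij_betw G (P \<union> (T - P)) (Q \<union> (T - Q))"
  proof (rule bij_betw_combine)
    show "bij_betw G P Q"
      using f by (rule bij_betw_cong[THEN iffD1, rotated]) (simp add: G_def)
    show "bij_betw G (T - P) (T - Q)"
      using g by (rule bij_betw_cong[THEN iffD1, rotated]) (simp add: G_def)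
  qed blast
  then have "bij_betw G T T" using sub by (simp add: Un_absorb1)
  then have G: "G permutes T" using sub by (intro bij_imp_permutes) (auto simp: G_def)
  have Ge: "G (e q) = v q" if "q \<in> J" for q
    using that e by (simp add: G_def P_def)
  have "bij_betw (\<lambda>\<tau>. G \<circ> \<tau>) {\<tau>. \<tau> permutes T - P}
      {\<sigma>. \<sigma> permutes T \<and> (\<forall>q\<in>J. \<sigma> (e q) = v q)}"
  proof (rule bij_betw_byWitness[where f' = "\<lambda>\<sigma>. inv G \<circ> \<sigma>"])
    show "\<forall>\<tau>\<in>{\<tau>. \<tau> permutes T - P}. inv G \<circ> (G \<circ> \<tau>) = \<tau>"
      using permutes_inv_o[OF G] by (simp add: comp_assoc[symmetric])
    show "\<forall>\<sigma>\<in>{\<sigma>. \<sigma> permutes T \<and> (\<forall>q\<in>J. \<sigma> (e q) = v q)}. G \<circ> (inv G \<circ> \<sigma>) = \<sigma>"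
      using permutes_inv_o[OF G] by (simp add: comp_assoc[symmetric])
    show "(\<lambda>\<tau>. G \<circ> \<tau>) ` {\<tau>. \<tau> permutes T - P}
        \<subseteq> {\<sigma>. \<sigma> permutes T \<and> (\<forall>q\<in>J. \<sigma> (e q) = v q)}"
    proof (clarify, intro conjI ballI)
      fix \<tau> assume \<tau>: "\<tau> permutes T - P"
      show "G \<circ> \<tau> permutes T"
        using \<tau> G by (meson Diff_subset permutes_compose permutes_subset)
      fix q assume "q \<in> J"
      then show "(G \<circ> \<tau>) (e q) = v q"
        using \<tau> Ge by (simp add: P_def permutes_not_in)
    qed
    show "(\<lambda>\<sigma>. inv G \<circ> \<sigma>) ` {\<sigma>. \<sigma> permutes T \<and> (\<forall>q\<in>J. \<sigma> (e q) = v q)}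
        \<subseteq> {\<tau>. \<tau> permutes T - P}"
    proof clarify
      fix \<sigma> assume \<sigma>: "\<sigma> permutes T" "\<forall>q\<in>J. \<sigma> (e q) = v q"
      have "inv G \<circ> \<sigma> permutes T"
        using \<sigma> G by (simp add: permutes_compose permutes_inv)
      moreover have "(inv G \<circ> \<sigma>) x = x" if "x \<in> P" for x
        using that \<sigma> Ge permutes_inverses(2)[OF G] by (auto simp: P_def) (metis)
      ultimately show "inv G \<circ> \<sigma> permutes T - P"
        by (auto intro: permutes_superset)
    qed
  qed
  then have "card {\<sigma>. \<sigma> permutes T \<and> (\<forall>q\<in>J. \<sigma> (e q) = v q)} = card {\<tau>. \<tau> permutes T - P}"
    by (simp add: bij_betw_same_card)
  also have "\<dots> = fact (card T - card J)"
    using T fin sub cardP by (subst card_permutations[OF refl]) (auto simp: card_Diff_subset)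
  finally show ?thesis .
qed


definition configurations :: "nat \<Rightarrow> nat \<Rightarrow> nat \<Rightarrow> (nat \<times> nat) set set" where
  "configurations p n s =
     {S. inj_on fst S \<and> inj_on snd S \<and> fst ` S \<in> placements p n s \<and> snd ` S \<in> placements p n s}"

lemma finite_configurations: "finite (configurations p n s)"
proof (rule finite_subset)
  show "configurations p n s \<subseteq> Pow ({..n} \<times> {..n})"
  proof
    fix S assume "S \<in> configurations p n s"
    then have "fst ` S \<in> Pow {..n}" "snd ` S \<in> Pow {..n}"
      unfolding configurations_def using placements_subset_Pow[of p n s] by blast+
    then show "S \<in> Pow ({..n} \<times> {..n})" by force
  qed
qed simp

lemma card_configurations:
  assumes "1 \<le> p"
  shows "card (configurations p n s) = (n - (p - 1) * s choose s)\<^sup>2 * fact s"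
proof -
  let ?P = "placements p n s"
  have "configurations p n s = (\<Union>x\<in>?P \<times> ?P. matchings (fst x) (snd x))"
    by (auto simp: configurations_def matchings_def)
  also have "card \<dots> = (\<Sum>x\<in>?P \<times> ?P. card (matchings (fst x) (snd x)))"
  proof (rule card_UN_disjoint)
    show "\<forall>x\<in>?P \<times> ?P. finite (matchings (fst x) (snd x))"
    proof
      fix x assume "x \<in> ?P \<times> ?P"
      then have "matchings (fst x) (snd x) \<subseteq> configurations p n s"
        by (auto simp: configurations_def matchings_def)
      then show "finite (matchings (fst x) (snd x))"
        by (rule finite_subset[OF _ finite_configurations])
    qed
    show "\<forall>x\<in>?P \<times> ?P. \<forall>y\<in>?P \<times> ?P. x \<noteq> y \<longrightarrow>
        matchings (fst x) (snd x) \<inter> matchings (fst y) (snd y) = {}"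
      by (auto simp: matchings_def)
  qed (simp add: finite_placements)
  also have "\<dots> = (\<Sum>x\<in>?P \<times> ?P. fact s)"
  proof (rule sum.cong[OF refl])
    fix x assume "x \<in> ?P \<times> ?P"
    then have "fst x \<in> ?P" "snd x \<in> ?P" by auto
    then have "finite (fst x)" "finite (snd x)" "card (fst x) = s" "card (snd x) = s"
      by (auto simp: finite_of_placement) (auto simp: placements_def)
    then show "card (matchings (fst x) (snd x)) = fact s"
      by (simp add: card_matchings)
  qed
  finally show ?thesis
    by (simp add: card_placements[OF assms] card_cartesian_product power2_eq_square)
qed

lemma occurrences_disjoint:
  assumes \<pi>: "\<pi> \<in> Sym p"
    and nso: "\<not> self_overlapping p \<pi>" "\<not> self_overlapping p (reverse_perm p \<pi>)"
    and \<sigma>: "\<sigma> \<in> Sym n" and p: "1 \<le> p"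
    and occ: "(i, h) \<in> very_tight_occurrences p \<pi> n \<sigma>" "(i', h') \<in> very_tight_occurrences p \<pi> n \<sigma>"
    and neq: "(i, h) \<noteq> (i', h')"
  shows "(i + p \<le> i' \<or> i' + p \<le> i) \<and> (h + p \<le> h' \<or> h' + p \<le> h)"
proof -
  have perm: "\<sigma> permutes {1..n}" using \<sigma> by (simp add: Sym_def)
  have o: "\<sigma> (i + j) = \<pi> j + h" "\<sigma> (i' + j) = \<pi> j + h'" if "j \<in> {1..p}" for j
    using occ that by (auto simp: very_tight_occurrences_def)
  consider "i < i'" | "i' < i" | "i = i'" by linarith
  then show ?thesis
  proof cases
    case 1
    then show ?thesis using occurrences_disjoint_aux[OF \<pi> nso perm o] by blast
  next
    case 2
    then show ?thesis using occurrences_disjoint_aux[OF \<pi> nso perm o(2) o(1)] by blast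
  next
    case 3
    then have "h = h'" using o[of 1] p by simp
    with 3 neq show ?thesis by simp
  qed
qed

lemma finite_occurrences: "finite (very_tight_occurrences p \<pi> n \<sigma>)"
  by (rule finite_subset[of _ "{..n} \<times> {..n}"]) (auto simp: very_tight_occurrences_def)

lemma occurrences_form_configuration:
  assumes \<pi>: "\<pi> \<in> Sym p"
    and nso: "\<not> self_overlapping p \<pi>" "\<not> self_overlapping p (reverse_perm p \<pi>)"
    and \<sigma>: "\<sigma> \<in> Sym n" and p: "1 \<le> p"
    and S: "S \<subseteq> very_tight_occurrences p \<pi> n \<sigma>"
  shows "S \<in> configurations p n (card S)"
proof -
  have disj: "(i + p \<le> i' \<or> i' + p \<le> i) \<and> (h + p \<le> h' \<or> h' + p \<le> h)"
    if "(i, h) \<in> S" "(i', h') \<in> S" "(i, h) \<noteq> (i', h')" for i h i' h'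
    using occurrences_disjoint[OF \<pi> nso \<sigma> p] that S by blast
  have inj: "inj_on fst S" "inj_on snd S"
    using disj p by (fastforce simp: inj_on_def)+
  have bound: "i + p \<le> n" "h + p \<le> n" if "(i, h) \<in> S" for i h
    using that S by (auto simp: very_tight_occurrences_def)
  have "separated p (fst ` S)"
    unfolding separated_def
  proof (intro ballI impI)
    fix a b assume "a \<in> fst ` S" "b \<in> fst ` S" "a < b"
    then obtain h h' where "(a, h) \<in> S" "(b, h') \<in> S" by force
    then show "a + p \<le> b" using disj[of a h b h'] \<open>a < b\<close> by auto
  qed
  moreover have "separated p (snd ` S)"
    unfolding separated_def
  proof (intro ballI impI)
    fix a b assume "a \<in> snd ` S" "b \<in> snd ` S" "a < b"
    then obtain i i' where "(i, a) \<in> S" "(i', b) \<in> S" by force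
    then show "a + p \<le> b" using disj[of i a i' b] \<open>a < b\<close> by auto
  qed
  ultimately show ?thesis
    using inj bound by (auto simp: configurations_def placements_def card_image)
qed

text \<open>
  Disjoint windows prescribe \<open>p s\<close> distinct values at \<open>p s\<close> distinct positions, so the remaining
  positions can be filled freely.
\<close>

lemma card_permutations_containing_configuration:
  assumes \<pi>: "\<pi> \<in> Sym p" and S: "S \<in> configurations p n s"
  shows "card {\<sigma> \<in> Sym n. S \<subseteq> very_tight_occurrences p \<pi> n \<sigma>} = fact (n - p * s)"
proof -
  \<comment> \<open>The pair \<open>((i, h), j)\<close> stands for the \<open>j\<close>-th entry of the occurrence \<open>(i, h)\<close>;
    \<open>e\<close> gives its position and \<open>v\<close> its value.\<close>
  define e where "e q = fst (fst q) + snd q" for q :: "(nat \<times> nat) \<times> nat"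
  define v where "v q = \<pi> (snd q) + snd (fst q)" for q :: "(nat \<times> nat) \<times> nat"
  let ?J = "S \<times> {1..p}"
  have perm: "\<pi> permutes {1..p}" using \<pi> by (simp add: Sym_def)
  have range: "\<pi> j \<in> {1..p}" if "j \<in> {1..p}" for j
    using that perm by (simp only: permutes_in_image)
  have inj: "inj_on fst S" "inj_on snd S" and sep: "separated p (fst ` S)" "separated p (snd ` S)"
    and bound: "\<And>q. q \<in> S \<Longrightarrow> fst q + p \<le> n \<and> snd q + p \<le> n" and cardS: "card S = s"
    using S card_image[of fst S] by (auto simp: configurations_def placements_def)
  have block: "a = b" if "separated p A" "a \<in> A" "b \<in> A" "a + j = b + j'"
    "j \<in> {1..p}" "j' \<in> {1..p}" for A and a b j j' :: nat
  proof (rule ccontr)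
    assume "a \<noteq> b"
    then have "a + p \<le> b \<or> b + p \<le> a"
      using that(1-3) unfolding separated_def by (metis nat_neq_iff)
    then show False using that(4-6) by auto
  qed
  have "inj_on e ?J"
  proof (rule inj_onI)
    fix x y assume xy: "x \<in> ?J" "y \<in> ?J" "e x = e y"
    obtain q j where x: "x = (q, j)" by fastforce
    obtain q' j' where y: "y = (q', j')" by fastforce
    have q: "q \<in> S" "q' \<in> S" "j \<in> {1..p}" "j' \<in> {1..p}" using xy x y by auto
    have eq: "fst q + j = fst q' + j'" using xy x y by (simp add: e_def)
    then have "fst q = fst q'"
      using block[OF sep(1) imageI[OF q(1)] imageI[OF q(2)] _ q(3,4)] by blast
    then show "x = y" using eq inj_onD[OF inj(1) _ q(1,2)] x y by simp
  qed
  moreover have "inj_on v ?J"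
  proof (rule inj_onI)
    fix x y assume xy: "x \<in> ?J" "y \<in> ?J" "v x = v y"
    obtain q j where x: "x = (q, j)" by fastforce
    obtain q' j' where y: "y = (q', j')" by fastforce
    have q: "q \<in> S" "q' \<in> S" "\<pi> j \<in> {1..p}" "\<pi> j' \<in> {1..p}"
      using xy x y range by auto
    have eq: "snd q + \<pi> j = snd q' + \<pi> j'" using xy x y by (simp add: v_def)
    then have *: "snd q = snd q'"
      using block[OF sep(2) imageI[OF q(1)] imageI[OF q(2)] _ q(3,4)] by blast
    then have "j = j'" using eq injD[OF permutes_inj[OF perm], of j j'] by simp
    then show "x = y" using * inj_onD[OF inj(2) _ q(1,2)] x y by simp
  qed
  moreover have "e ` ?J \<subseteq> {1..n}" "v ` ?J \<subseteq> {1..n}"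
  proof -
    have "e q \<in> {1..n} \<and> v q \<in> {1..n}" if "q \<in> ?J" for q
    proof -
      have "fst q \<in> S" "snd q \<in> {1..p}" using that by auto
      then show ?thesis using bound[of "fst q"] range[of "snd q"] by (auto simp: e_def v_def)
    qed
    then show "e ` ?J \<subseteq> {1..n}" "v ` ?J \<subseteq> {1..n}" by blast+
  qed
  ultimately have "card {\<sigma>. \<sigma> permutes {1..n} \<and> (\<forall>q\<in>?J. \<sigma> (e q) = v q)} = fact (n - card ?J)"
    using card_permutations_prescribed[of "{1..n}" e ?J v] by simp
  moreover have "{\<sigma>. \<sigma> permutes {1..n} \<and> (\<forall>q\<in>?J. \<sigma> (e q) = v q)} =
      {\<sigma> \<in> Sym n. S \<subseteq> very_tight_occurrences p \<pi> n \<sigma>}"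
  proof -
    have "(\<forall>q\<in>?J. \<sigma> (e q) = v q) \<longleftrightarrow> S \<subseteq> very_tight_occurrences p \<pi> n \<sigma>" for \<sigma>
    proof -
      have "S \<subseteq> very_tight_occurrences p \<pi> n \<sigma> \<longleftrightarrow>
          (\<forall>q\<in>S. \<forall>j\<in>{1..p}. \<sigma> (fst q + j) = \<pi> j + snd q)"
        using bound by (force simp: very_tight_occurrences_def)
      then show ?thesis by (simp add: e_def v_def)
    qed
    then show ?thesis by (simp add: Sym_def)
  qed
  moreover have "card ?J = p * s" using cardS by (simp add: card_cartesian_product)
  ultimately show ?thesis by simp
qed

lemma finite_Sym: "finite (Sym n)"
  by (simp add: Sym_def finite_permutations)

lemma card_Sym: "card (Sym n) = fact n"
  using card_permutations[of "{1..n}" n] by (simp add: Sym_def)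

text \<open>
  Double counting of the pairs of a permutation and a set of \<open>s\<close> of its occurrences. One of the two
  factors \<open>N choose s\<close> in the number of configurations, with \<open>N = n - (p - 1) s\<close>, is absorbed together
  with \<open>s!\<close> and \<open>(n - p s)! = (N - s)!\<close> into \<open>N!\<close>.
\<close>

lemma sum_choose_occurrences:
  assumes \<pi>: "\<pi> \<in> Sym p"
    and nso: "\<not> self_overlapping p \<pi>" "\<not> self_overlapping p (reverse_perm p \<pi>)"
    and p: "1 \<le> p" and n: "p * s \<le> n"
  shows "(\<Sum>\<sigma>\<in>Sym n. card (very_tight_occurrences p \<pi> n \<sigma>) choose s) =
    (n - (p - 1) * s choose s) * fact (n - (p - 1) * s)"
proof -
  let ?V = "very_tight_occurrences p \<pi> n"
  let ?C = "configurations p n s"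
  let ?N = "n - (p - 1) * s"
  have subsets: "card (?V \<sigma>) choose s = card {S. S \<in> ?C \<and> S \<subseteq> ?V \<sigma>}" if "\<sigma> \<in> Sym n" for \<sigma>
  proof -
    have "card S = s \<longleftrightarrow> S \<in> ?C" if S: "S \<subseteq> ?V \<sigma>" for S
    proof
      assume "card S = s"
      then show "S \<in> ?C"
        using occurrences_form_configuration[OF \<pi> nso \<open>\<sigma> \<in> Sym n\<close> p S] by simp
    next
      assume "S \<in> ?C"
      then have "inj_on fst S" "card (fst ` S) = s" by (simp_all add: configurations_def placements_def)
      then show "card S = s" by (simp add: card_image)
    qed
    then have "{S. S \<in> ?C \<and> S \<subseteq> ?V \<sigma>} = {S. S \<subseteq> ?V \<sigma> \<and> card S = s}" by blast
    then show ?thesis by (simp only: n_subsets[OF finite_occurrences])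
  qed
  have "(\<Sum>\<sigma>\<in>Sym n. card (?V \<sigma>) choose s) = (\<Sum>\<sigma>\<in>Sym n. card {S. S \<in> ?C \<and> S \<subseteq> ?V \<sigma>})"
    by (intro sum.cong refl subsets)
  also have "\<dots> = (\<Sum>S\<in>?C. card {\<sigma> \<in> Sym n. S \<subseteq> ?V \<sigma>})"
    unfolding card_eq_sum by (rule sum.swap_restrict[OF finite_Sym finite_configurations])
  also have "\<dots> = card ?C * fact (n - p * s)"
    by (simp add: card_permutations_containing_configuration[OF \<pi>])
  also have "\<dots> = (?N choose s) * (fact s * fact (n - p * s) * (?N choose s))"
    unfolding card_configurations[OF p] power2_eq_square by (simp only: ac_simps)
  also have "fact s * fact (n - p * s) * (?N choose s) = fact ?N"
  proof -
    have eq: "s + (p - 1) * s = p * s" using p by (cases p) simp_all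
    then have "s + (p - 1) * s \<le> n" using n by (simp only:)
    then have "s \<le> ?N" by (rule add_le_imp_le_diff)
    moreover have "n - p * s = ?N - s" unfolding eq[symmetric] by (simp only: diff_diff_left add.commute)
    ultimately show ?thesis using binomial_fact_lemma[of s ?N] by (simp only:)
  qed
  finally show ?thesis .
qed

section \<open>Factorial moments in inverse falling factorials\<close>

text \<open>
  Vandermonde's identity for \<open>s + (- x - 1)\<close>, read through the negation of upper indices on both
  sides. The products \<open>(x + 1) \<cdots> (x + l)\<close> on the right are what cancels in an inverse falling
  factorial.
\<close>

lemma binomial_alternating_expansion:
  "real (x choose s) = (\<Sum>l\<le>s. (-1) ^ (s - l) * real (s choose l) * real (x + l choose l))"
proof -
  have upper: "(- real x - 1) gchoose l = (-1) ^ l * real (x + l choose l)" for l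
    by (subst gbinomial_negated_upper) (simp add: binomial_gbinomial algebra_simps)
  have "real (x choose s) = (-1) ^ s * ((real s - real x - 1) gchoose s)"
    by (simp add: binomial_gbinomial gbinomial_negated_upper[of "real x"])
  also have "(real s - real x - 1) gchoose s =
      (\<Sum>l\<le>s. ((- real x - 1) gchoose l) * (real s gchoose (s - l)))"
    using gbinomial_Vandermonde[of "- real x - 1" "real s" s]
    by (simp add: atLeast0AtMost algebra_simps)
  also have "(-1) ^ s * \<dots> = (\<Sum>l\<le>s. (-1) ^ (s - l) * real (s choose l) * real (x + l choose l))"
    unfolding sum_distrib_left
  proof (rule sum.cong[OF refl])
    fix l assume "l \<in> {..s}"
    then have "l \<le> s" by simp
    then have "(-1) ^ s * (-1) ^ l = ((-1) ^ (s - l) :: real)"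
      by (simp flip: power_add add: minus_one_power_iff)
    moreover have "real s gchoose (s - l) = real (s choose l)"
      using \<open>l \<le> s\<close> by (simp flip: binomial_gbinomial binomial_symmetric)
    ultimately show "(-1) ^ s * (((- real x - 1) gchoose l) * (real s gchoose (s - l))) =
        (-1) ^ (s - l) * real (s choose l) * real (x + l choose l)"
      unfolding upper by (simp flip: mult.assoc)
  qed
  finally show ?thesis .
qed

lemma falling_factorial_eq:
  assumes "k \<le> n"
  shows "falling_factorial n k = fact n / fact (n - k)"
  using assms
proof (induction k)
  case (Suc k)
  then have "n - k = Suc (n - Suc k)" by simp
  then have "(fact (n - k) :: real) = (real n - real k) * fact (n - Suc k)"
    using Suc.prems by (simp add: of_nat_diff)
  with Suc show ?case by (simp add: falling_factorial_def)
qed (simp add: falling_factorial_def)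

text \<open>
  Up to the sign \<open>(-1) ^ i\<close>, the coefficient of order \<open>k\<close> in the \<open>i\<close>-th binomial moment. It is extended
  by zero outside the range in which the truncated subtractions are exact, so that sums over \<open>i\<close> and
  over \<open>k\<close> can be exchanged.
\<close>

definition moment_coeff :: "nat \<Rightarrow> nat \<Rightarrow> nat \<Rightarrow> real" where
  "moment_coeff p i k =
     (if (p - 2) * i \<le> k \<and> k \<le> (p - 1) * i
      then (-1) ^ ((p - 1) * i - k) / fact ((p - 1) * i - k) * real (i choose (k - (p - 2) * i))
      else 0)"

text \<open>
  With \<open>M = (p - 1) i\<close>, the falling factorials of orders \<open>M\<close> and \<open>M - l\<close> differ by the factor
  \<open>(x + 1) \<cdots> (x + l)\<close> for \<open>x = n - M\<close>. The \<open>l\<close>-th term of the alternating expansion is therefore the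
  term of order \<open>k = M - l\<close>.
\<close>

lemma moment_expansion:
  assumes p: "2 \<le> p" and n: "(p - 1) * i \<le> n" and K: "(p - 1) * i < K"
  shows "(-1) ^ i * (real (n - (p - 1) * i choose i) * fact (n - (p - 1) * i) / fact n) =
    (\<Sum>k<K. moment_coeff p i k / falling_factorial n k)"
proof -
  let ?M = "(p - 1) * i"
  let ?x = "n - ?M"
  have M: "(p - 2) * i + i = ?M"
  proof -
    have "p - 1 = Suc (p - 2)" using p by simp
    then show ?thesis by simp
  qed
  have "(-1) ^ i * (real (?x choose i) * fact ?x / fact n) =
      (\<Sum>l\<le>i. (-1) ^ l / fact l * real (i choose l) * (fact (?x + l) / fact n))"
    unfolding binomial_alternating_expansion[of ?x i] sum_distrib_left sum_distrib_right
      sum_divide_distrib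
  proof (rule sum.cong[OF refl])
    fix l assume "l \<in> {..i}"
    then have "l \<le> i" by simp
    then have sign: "(-1) ^ i * (-1) ^ (i - l) = ((-1) ^ l :: real)"
      by (simp flip: power_add add: minus_one_power_iff)
    have binom: "real (?x + l choose l) * fact ?x = fact (?x + l) / fact l"
      by (simp add: binomial_fact)
    have "(-1) ^ i * ((-1) ^ (i - l) * real (i choose l) * real (?x + l choose l) * fact ?x / fact n) =
        ((-1) ^ i * (-1) ^ (i - l)) * real (i choose l) * (real (?x + l choose l) * fact ?x) / fact n"
      by (simp only: mult.assoc times_divide_eq_right)
    also have "\<dots> = (-1) ^ l / fact l * real (i choose l) * (fact (?x + l) / fact n)"
      unfolding sign binom by simp
    finally show "(-1) ^ i * ((-1) ^ (i - l) * real (i choose l) * real (?x + l choose l) *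
        fact ?x / fact n) = (-1) ^ l / fact l * real (i choose l) * (fact (?x + l) / fact n)" .
  qed
  also have "\<dots> = (\<Sum>k = (p - 2) * i..?M. moment_coeff p i k / falling_factorial n k)"
  proof (rule sum.reindex_bij_witness[of _ "\<lambda>k. ?M - k" "\<lambda>l. ?M - l"])
    fix l assume "l \<in> {..i}"
    then have l: "l \<le> i" by simp
    have "?M - l - (p - 2) * i = i - l" "?M - (?M - l) = l" "(p - 2) * i \<le> ?M - l"
      "n - (?M - l) = ?x + l" "?M - l \<le> n"
      using l M n by auto
    then show "moment_coeff p i (?M - l) / falling_factorial n (?M - l) =
        (-1) ^ l / fact l * real (i choose l) * (fact (?x + l) / fact n)"
      using l by (simp add: moment_coeff_def falling_factorial_eq binomial_symmetric[of l i])
  qed (use M in auto)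
  also have "\<dots> = (\<Sum>k<K. moment_coeff p i k / falling_factorial n k)"
    using K by (intro sum.mono_neutral_left) (auto simp: moment_coeff_def)
  finally show ?thesis .
qed

text \<open>
  The rounded bounds of summation say \<open>(p - 2) i \<le> k \<le> (p - 1) i\<close>, and \<open>p \<ge> 3\<close> then forces
  \<open>i \<le> k\<close>. Hence all moments that contribute to the order \<open>k\<close> have an index below any \<open>I > k\<close>.
\<close>

lemma vt_coeff_eq:
  assumes p: "3 \<le> p" and I: "k < I"
  shows "vt_coeff p m k = (-1) ^ m * (\<Sum>i<I. real (i choose m) * moment_coeff p i k)"
proof -
  have lower: "nat \<lceil>real k / real (p - 1)\<rceil> \<le> i \<longleftrightarrow> k \<le> (p - 1) * i" for i
  proof -
    have "nat \<lceil>real k / real (p - 1)\<rceil> \<le> i \<longleftrightarrow> real k / real (p - 1) \<le> real i"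
      by (simp add: nat_le_iff ceiling_le_iff)
    also have "\<dots> \<longleftrightarrow> real k \<le> real ((p - 1) * i)"
      using p by (simp add: pos_divide_le_eq mult.commute)
    finally show ?thesis by (simp only: of_nat_le_iff)
  qed
  have upper: "i \<le> nat \<lfloor>real k / real (p - 2)\<rfloor> \<longleftrightarrow> (p - 2) * i \<le> k" for i
  proof -
    have "i \<le> nat \<lfloor>real k / real (p - 2)\<rfloor> \<longleftrightarrow> real i \<le> real k / real (p - 2)"
      by (simp add: le_nat_iff le_floor_iff)
    also have "\<dots> \<longleftrightarrow> real ((p - 2) * i) \<le> real k"
      using p by (simp add: pos_le_divide_eq mult.commute)
    finally show ?thesis by (simp only: of_nat_le_iff)
  qed
  have small: "i < I" if "(p - 2) * i \<le> k" for i
  proof -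
    have "1 * i \<le> (p - 2) * i" using p by (intro mult_right_mono) auto
    then show ?thesis using that I by linarith
  qed
  have "{nat \<lceil>real k / real (p - 1)\<rceil>..nat \<lfloor>real k / real (p - 2)\<rfloor>} =
      {i. (p - 2) * i \<le> k \<and> k \<le> (p - 1) * i}"
    by (auto simp only: atLeastAtMost_iff mem_Collect_eq lower upper)
  then show ?thesis
    unfolding vt_coeff_def
    using small by (auto intro!: arg_cong[of _ _ "(*) _"] sum.mono_neutral_cong_left
        simp: moment_coeff_def)
qed

lemma vt_coeff_eq_0:
  assumes "3 \<le> p" "k < (p - 2) * m"
  shows "vt_coeff p m k = 0"
proof -
  have "real (i choose m) * moment_coeff p i k = 0" for i
  proof (cases "i < m")
    case False
    then have "(p - 2) * m \<le> (p - 2) * i" by (intro mult_le_mono2) simp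
    then have "\<not> (p - 2) * i \<le> k" using assms(2) by linarith
    then show ?thesis by (simp add: moment_coeff_def)
  qed simp
  then show ?thesis
    unfolding vt_coeff_eq[OF assms(1) lessI] by (simp only: sum.neutral_const mult_zero_right)
qed

section \<open>Truncated inclusion and exclusion\<close>

text \<open>
  Factoring \<open>(X choose i) (i choose m) = (X choose m) (X - m choose i - m)\<close> leaves an alternating row
  sum of binomial coefficients, whose partial sums are again, up to sign, binomial coefficients. For
  \<open>X > m\<close> the error is thus \<open>(X choose m) (X - m - 1 choose I - m - 1)\<close>, which Pascal's rule bounds by
  \<open>(X choose m) (X - m choose I - m)\<close>.
\<close>

lemma exactly_m_truncated:
  fixes X m I :: nat
  assumes "m < I"
  shows "\<bar>of_bool (X = m) - (\<Sum>i<I. (-1) ^ (i + m) * real (i choose m) * real (X choose i))\<bar>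
    \<le> real (I choose m) * real (X choose I)"
proof (cases "X < m")
  case True
  then have "(i choose m) = 0 \<or> (X choose i) = 0" for i by (cases "i < m") auto
  then have "(\<Sum>i<I. (-1) ^ (i + m) * real (i choose m) * real (X choose i)) = 0"
    by (intro sum.neutral) (metis mult_eq_0_iff of_nat_0)
  then show ?thesis using True by simp
next
  case False
  define J where "J = I - m - 1"
  have I: "I = m + J + 1" using assms by (simp add: J_def)
  have "(\<Sum>i<I. (-1) ^ (i + m) * real (i choose m) * real (X choose i)) =
      (\<Sum>i = m..<I. (-1) ^ (i + m) * real (i choose m) * real (X choose i))"
    by (intro sum.mono_neutral_right) auto
  also have "\<dots> = (\<Sum>j\<le>J. (-1) ^ j * (real (X choose m) * real (X - m choose j)))"
  proof (rule sum.reindex_bij_witness[of _ "\<lambda>j. j + m" "\<lambda>i. i - m"])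
    fix i assume i: "i \<in> {m..<I}"
    have "(X choose i) * (i choose m) = (X choose m) * (X - m choose (i - m))"
    proof (cases "i \<le> X")
      case True
      then show ?thesis using i by (simp add: choose_mult)
    next
      case False
      then have "X < i" "X - m < i - m" using \<open>\<not> X < m\<close> by linarith+
      then show ?thesis by (simp only: binomial_eq_0 mult_0 mult_0_right)
    qed
    then have "real (X choose m) * real (X - m choose (i - m)) = real (i choose m) * real (X choose i)"
      by (metis mult.commute of_nat_mult)
    moreover have "(-1) ^ (i - m) = ((-1) ^ (i + m) :: real)"
      using i by (simp add: minus_one_power_iff)
    ultimately show "(-1) ^ (i - m) * (real (X choose m) * real (X - m choose (i - m))) =
        (-1) ^ (i + m) * real (i choose m) * real (X choose i)" by simp
  qed (use I in auto)
  also have "\<dots> = real (X choose m) * (\<Sum>j\<le>J. (real (X - m) gchoose j) * (-1) ^ j)"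
    by (simp add: sum_distrib_left binomial_gbinomial ac_simps)
  also have "\<dots> = real (X choose m) * ((-1) ^ J * ((real (X - m) - 1) gchoose J))"
    by (simp only: gbinomial_sum_lower_neg)
  finally have sum: "(\<Sum>i<I. (-1) ^ (i + m) * real (i choose m) * real (X choose i)) =
    real (X choose m) * ((-1) ^ J * ((real (X - m) - 1) gchoose J))" .
  show ?thesis
  proof (cases "X = m")
    case True
    have "(-1 :: real) gchoose J = (-1) ^ J"
      by (subst gbinomial_negated_upper) (simp flip: binomial_gbinomial)
    then show ?thesis using sum True by simp
  next
    case neq: False
    with False have X: "m < X" by simp
    then have pred: "real (X - m) - 1 = real (X - m - 1)" by (simp add: of_nat_diff)
    have "\<bar>of_bool (X = m) - (\<Sum>i<I. (-1) ^ (i + m) * real (i choose m) * real (X choose i))\<bar> =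
        real ((X choose m) * (X - m - 1 choose J))"
      unfolding sum pred using neq by (simp add: abs_mult flip: binomial_gbinomial)
    also have "\<dots> \<le> real ((X choose I) * (I choose m))"
    proof (cases "I \<le> X")
      case True
      have "X - m = Suc (X - m - 1)" "I - m = Suc J" using X I by auto
      then have "(X - m - 1 choose J) \<le> (X - m choose (I - m))" by simp
      then have "(X choose m) * (X - m - 1 choose J) \<le> (X choose I) * (I choose m)"
        using choose_mult[of m I X] assms True by simp
      then show ?thesis by (simp only: of_nat_le_iff)
    next
      case False
      then have "X - m - 1 < J" using I X by linarith
      then show ?thesis by (simp only: binomial_eq_0 mult_0_right of_nat_0 of_nat_0_le_iff)
    qed
    finally show ?thesis by (simp only: of_nat_mult mult.commute)
  qed
qed

text \<open>For \<open>n > 2 k\<close> every factor of the falling factorial is at least \<open>n / 2\<close>.\<close>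

lemma inverse_falling_factorial_bigo:
  assumes "r \<le> k"
  shows "(\<lambda>n. c / falling_factorial n k) \<in> O(\<lambda>n. 1 / real n ^ r)"
proof (rule bigoI[where c = "\<bar>c\<bar> * 2 ^ k"])
  show "\<forall>\<^sub>F n in sequentially.
      norm (c / falling_factorial n k) \<le> \<bar>c\<bar> * 2 ^ k * norm (1 / real n ^ r)"
    using eventually_ge_at_top[of "2 * k + 1"]
  proof eventually_elim
    case (elim n)
    have "(real n / 2) ^ k = (\<Prod>j<k. real n / 2)" by simp
    also have "\<dots> \<le> falling_factorial n k"
      unfolding falling_factorial_def using elim by (intro prod_mono) auto
    finally have ff: "(real n / 2) ^ k \<le> falling_factorial n k" .
    have "real n ^ r \<le> real n ^ k" using elim assms by (intro power_increasing) auto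
    then have "real n ^ r \<le> 2 ^ k * falling_factorial n k"
      using ff by (simp add: power_divide field_simps)
    then have "\<bar>c\<bar> * real n ^ r \<le> \<bar>c\<bar> * (2 ^ k * falling_factorial n k)"
      by (rule mult_left_mono) simp
    moreover have "0 < falling_factorial n k"
      using ff elim by (metis less_le_trans zero_less_power half_gt_zero_iff of_nat_0_less_iff
          Suc_eq_plus1 Suc_le_lessD gr_zeroI not_less_zero)
    ultimately show ?case using elim
      by (simp add: divide_simps abs_mult mult.assoc)
  qed
qed

section \<open>The asymptotic expansion\<close>

theorem theorem4p2:
  fixes p m r :: nat and \<pi> :: "nat \<Rightarrow> nat"
  assumes "p \<ge> 3"
    and "\<pi> \<in> Sym p"
    and "\<not> self_overlapping p \<pi>"
    and "\<not> self_overlapping p (reverse_perm p \<pi>)"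
    and "r \<ge> 1"
  shows "(\<lambda>n. prob_very_tight p \<pi> m n
              - (\<Sum>k = (p - 2) * m..r - 1. vt_coeff p m k / falling_factorial n k))
         \<in> O(\<lambda>n. 1 / real n ^ r)"
proof -
  \<comment> \<open>Truncation at \<open>I\<close> needs \<open>I > m\<close>, and \<open>I \<ge> r\<close> makes the first omitted moment of order
    \<open>(p - 2) I \<ge> r\<close>. All moments up to \<open>I\<close> have orders below \<open>K\<close>.\<close>
  define I where "I = max r (m + 1)"
  define K where "K = (p - 1) * I + 1"
  define X where "X n \<sigma> = card (very_tight_occurrences p \<pi> n \<sigma>)" for n \<sigma>
  define a where "a k = (-1) ^ m * (\<Sum>i<I. real (i choose m) * moment_coeff p i k)" for k
  have p: "1 \<le> p" "2 \<le> p" using assms(1) by auto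
  have I: "r \<le> I" "m < I" by (auto simp: I_def)
  have "1 * I \<le> (p - 1) * I" using assms(1) by (intro mult_right_mono) auto
  then have "I \<le> (p - 1) * I" by (simp only: mult_1)
  then have K: "r < K" using I(1) unfolding K_def by linarith
  have a: "a k = vt_coeff p m k" if "k < r" for k
    unfolding a_def using vt_coeff_eq[OF assms(1), of k I m] that I by simp
  have moment: "(-1) ^ i * ((\<Sum>\<sigma>\<in>Sym n. real (X n \<sigma> choose i)) / fact n) =
      (\<Sum>k<K. moment_coeff p i k / falling_factorial n k)"
    if i: "i \<le> I" and n: "p * I \<le> n" for i n
  proof -
    have le: "p * i \<le> n" using i n by (meson le_trans mult_le_mono2)
    have "(p - 1) * i \<le> p * i" by simp
    then have le': "(p - 1) * i \<le> n" using le by linarith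
    have "(p - 1) * i < K" using i by (simp add: K_def le_imp_less_Suc)
    moreover have "(\<Sum>\<sigma>\<in>Sym n. real (X n \<sigma> choose i)) =
        real ((n - (p - 1) * i choose i) * fact (n - (p - 1) * i))"
      using sum_choose_occurrences[OF assms(2-4) p(1) le] unfolding X_def by (metis of_nat_sum)
    ultimately show ?thesis
      using moment_expansion[OF p(2) le', of K] by simp
  qed
  have prob: "prob_very_tight p \<pi> m n = (\<Sum>\<sigma>\<in>Sym n. of_bool (X n \<sigma> = m)) / fact n" for n
  proof -
    have ne: "Sym n \<noteq> {}" using card_Sym[of n] by force
    have "prob_very_tight p \<pi> m n = real (card (Sym n \<inter> {\<sigma>. X n \<sigma> = m})) / real (card (Sym n))"
      unfolding prob_very_tight_def X_def by (rule measure_pmf_of_set[OF ne finite_Sym])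
    then show ?thesis by (simp add: card_Sym finite_Sym sum_of_bool_eq Int_def)
  qed
  have expansion: "(\<Sum>\<sigma>\<in>Sym n. \<Sum>i<I. (-1) ^ (i + m) * real (i choose m) * real (X n \<sigma> choose i)) / fact n =
      (\<Sum>k<K. a k / falling_factorial n k)" if n: "p * I \<le> n" for n
  proof -
    have "(\<Sum>\<sigma>\<in>Sym n. \<Sum>i<I. (-1) ^ (i + m) * real (i choose m) * real (X n \<sigma> choose i)) / fact n =
        (\<Sum>i<I. (-1) ^ m * real (i choose m) *
          ((-1) ^ i * ((\<Sum>\<sigma>\<in>Sym n. real (X n \<sigma> choose i)) / fact n)))"
      by (subst sum.swap)
        (simp add: sum_divide_distrib sum_distrib_left power_add ac_simps)
    also have "\<dots> = (\<Sum>i<I. \<Sum>k<K. (-1) ^ m * real (i choose m) *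
        (moment_coeff p i k / falling_factorial n k))"
      unfolding sum_distrib_left[symmetric] using n
      by (intro sum.cong refl arg_cong[of _ _ "(*) _"] moment) auto
    also have "\<dots> = (\<Sum>k<K. a k / falling_factorial n k)"
      by (subst sum.swap) (simp add: a_def sum_divide_distrib sum_distrib_left ac_simps)
    finally show ?thesis .
  qed
  have error: "\<bar>prob_very_tight p \<pi> m n - (\<Sum>k<K. a k / falling_factorial n k)\<bar> \<le>
      (\<Sum>k = r..<K. (-1) ^ I * real (I choose m) * moment_coeff p I k / falling_factorial n k)"
    if n: "p * I \<le> n" for n
  proof -
    let ?d = "\<lambda>\<sigma>. of_bool (X n \<sigma> = m) -
      (\<Sum>i<I. (-1) ^ (i + m) * real (i choose m) * real (X n \<sigma> choose i))"
    have "\<bar>prob_very_tight p \<pi> m n - (\<Sum>k<K. a k / falling_factorial n k)\<bar> =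
        \<bar>\<Sum>\<sigma>\<in>Sym n. ?d \<sigma>\<bar> / fact n"
      unfolding prob expansion[OF n, symmetric]
      by (simp add: sum_subtractf flip: diff_divide_distrib)
    also have "\<dots> \<le> (\<Sum>\<sigma>\<in>Sym n. real (I choose m) * real (X n \<sigma> choose I)) / fact n"
      using exactly_m_truncated[OF I(2)]
      by (intro divide_right_mono order_trans[OF sum_abs] sum_mono) auto
    also have "\<dots> = (-1) ^ I * real (I choose m) *
        ((-1) ^ I * ((\<Sum>\<sigma>\<in>Sym n. real (X n \<sigma> choose I)) / fact n))"
      by (simp add: sum_distrib_left flip: mult.assoc power_add) (simp add: ac_simps)
    also have "\<dots> = (\<Sum>k<K. (-1) ^ I * real (I choose m) * moment_coeff p I k / falling_factorial n k)"
      unfolding moment[OF order_refl n] sum_distrib_left by simp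
    also have "\<dots> = (\<Sum>k = r..<K. (-1) ^ I * real (I choose m) * moment_coeff p I k / falling_factorial n k)"
    proof (rule sum.mono_neutral_right)
      have "1 * I \<le> (p - 2) * I" using assms(1) by (intro mult_right_mono) auto
      then have "\<not> (p - 2) * I \<le> k" if "k < r" for k
        using that I(1) by linarith
      then have "moment_coeff p I k = 0" if "k < r" for k
        using that by (simp add: moment_coeff_def)
      then show "\<forall>k\<in>{..<K} - {r..<K}.
          (-1) ^ I * real (I choose m) * moment_coeff p I k / falling_factorial n k = 0"
        by auto
    qed auto
    finally show ?thesis .
  qed
  have split: "(\<Sum>k<K. a k / falling_factorial n k) =
      (\<Sum>k = (p - 2) * m..r - 1. vt_coeff p m k / falling_factorial n k) +
      (\<Sum>k = r..<K. a k / falling_factorial n k)" for n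
  proof -
    have "(\<Sum>k<r. vt_coeff p m k / falling_factorial n k) =
        (\<Sum>k = (p - 2) * m..r - 1. vt_coeff p m k / falling_factorial n k)"
      using assms(5) vt_coeff_eq_0[OF assms(1)]
      by (intro sum.mono_neutral_right) auto
    moreover have "(\<Sum>k<K. a k / falling_factorial n k) =
        (\<Sum>k<r. a k / falling_factorial n k) + (\<Sum>k = r..<K. a k / falling_factorial n k)"
      using K by (simp add: lessThan_atLeast0 sum.atLeastLessThan_concat)
    ultimately show ?thesis by (simp add: a)
  qed
  have tail: "(\<lambda>n. \<Sum>k = r..<K. c k / falling_factorial n k) \<in> O(\<lambda>n. 1 / real n ^ r)"
    for c :: "nat \<Rightarrow> real"
    by (intro big_sum_in_bigo inverse_falling_factorial_bigo) auto
  have "(\<lambda>n. prob_very_tight p \<pi> m n - (\<Sum>k<K. a k / falling_factorial n k))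
      \<in> O(\<lambda>n. \<Sum>k = r..<K. (-1) ^ I * real (I choose m) * moment_coeff p I k / falling_factorial n k)"
    using eventually_ge_at_top[of "p * I"]
    by (intro bigoI[where c = 1], elim eventually_mono) (use error in force)
  then have "(\<lambda>n. prob_very_tight p \<pi> m n - (\<Sum>k<K. a k / falling_factorial n k))
      \<in> O(\<lambda>n. 1 / real n ^ r)"
    using tail by (rule landau_o.big_trans)
  from sum_in_bigo(1)[OF this tail[of a]] show ?thesis by (simp add: split)
qed

end
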